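(* Let $T$ be a bounded linear operator on a real Hilbert space $\mathcal{H}$, and let $T_{\mathbb{C}}$ be its complexification, acting on the complexified Hilbert space $\mathcal{H}_{\mathbb{C}}$. Then $$\mathrm{SRG}(T)=\begin{cases}\partial\,\mathrm{SRG}(T_{\mathbb{C}}) & \text{if }\mathcal{H}\text{ has (real) dimension }2;\\ \mathrm{SRG}(T_{\mathbb{C}}) & \text{otherwise (including the infinite dimensional case).}\end{cases}$$
   Context: Scaled relative graph: for a bounded linear operator $T$ on a real or complex Hilbert space $\mathcal{H}$ with inner product $\langle\cdot,\cdot\rangle$ and norm $\|\cdot\|$, $$\mathrm{SRG}(T)=\left\{\frac{\|y\|}{\|x\|}\exp\left(\pm i\arccos\left(\frac{\mathrm{Re}\langle y,x\rangle}{\|y\|\,\|x\|}\right)\right): x\in\mathcal{H},\ \|x\|=1,\ y=Tx\right\}\subseteq\mathbb{C},$$ where both signs are included, and the element contributed by $x$ is understood to be $0$ when $Tx=0$. In both the real and the complex case this is a subset of $\mathbb{C}$. Boundary: for $s\subseteq\mathbb{C}$, $\partial s=\mathrm{cl}(s)\cap\mathrm{cl}(\mathbb{C}\setminus s)$, with closures taken in $\mathbb{C}$. Complexification: for a real Hilbert space $\mathcal{H}$, $\mathcal{H}_{\mathbb{C}}$ is a complex Hilbert space together with a (real-)linear map $U:\mathcal{H}\to\mathcal{H}_{\mathbb{C}}$ such that $\langle Ux_1,Ux_2\rangle=\langle x_1,x_2\rangle$ for all $x_1,x_2\in\mathcal{H}$, and for every $y\in\mathcal{H}_{\mathbb{C}}$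 there are unique $x_1,x_2\in\mathcal{H}$ with $y=Ux_1+iUx_2$. The complexification of $T$ is the operator $T_{\mathbb{C}}$ on $\mathcal{H}_{\mathbb{C}}$ with $T_{\mathbb{C}}(Ux_1+iUx_2)=UTx_1+iUTx_2$ for all $x_1,x_2\in\mathcal{H}$. *)

theory Defs
  imports "HOL-Analysis.Analysis"
begin

class complex_vector = real_vector +
  fixes scaleC :: "complex \<Rightarrow> 'a \<Rightarrow> 'a"  (infixr \<open>*\<^sub>C\<close> 75)
  assumes scaleC_add_right: "a *\<^sub>C (x + y) = a *\<^sub>C x + a *\<^sub>C y"
    and scaleC_add_left: "(a + b) *\<^sub>C x = a *\<^sub>C x + b *\<^sub>C x"
    and scaleC_scaleC: "a *\<^sub>C (b *\<^sub>C x) = (a * b) *\<^sub>C x"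
    and scaleC_of_real: "complex_of_real r *\<^sub>C x = r *\<^sub>R x"

class complex_inner = complex_vector + real_normed_vector +
  fixes cinner :: "'a \<Rightarrow> 'a \<Rightarrow> complex"
  assumes cinner_commute: "cinner x y = cnj (cinner y x)"
    and cinner_add_left: "cinner (x + y) z = cinner x z + cinner y z"
    and cinner_scaleC_left: "cinner (a *\<^sub>C x) y = a * cinner x y"
    and cinner_ge_zero: "0 \<le> Re (cinner x x)"
    and cinner_eq_zero_iff: "cinner x x = 0 \<longleftrightarrow> x = 0"
    and norm_eq_sqrt_cinner: "norm x = sqrt (Re (cinner x x))"

class chilbert_space = complex_inner + complete_space

instantiation complex :: chilbert_space
begin

definition scaleC_complex :: "complex \<Rightarrow> complex \<Rightarrow> complex" where
  "scaleC_complex a x = a * x"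

definition cinner_complex :: "complex \<Rightarrow> complex \<Rightarrow> complex" where
  "cinner_complex x y = x * cnj y"

instance
  by standard
    (auto simp: scaleC_complex_def cinner_complex_def algebra_simps scaleR_conv_of_real
      cmod_def power2_eq_square)

end

text \<open>
  The first argument is the inner product of the underlying space, so that the same definition
  serves real and complex spaces. If \<open>T x = 0\<close>, then the factor \<open>norm y / norm x\<close> vanishes and
  \<open>x\<close> contributes exactly the element \<open>0\<close>.
\<close>

definition SRG :: "('v \<Rightarrow> 'v \<Rightarrow> complex) \<Rightarrow> ('v::real_normed_vector \<Rightarrow> 'v) \<Rightarrow> complex set" where
  "SRG ip T =
    {complex_of_real (norm y / norm x) *
       exp (s * (\<i> * complex_of_real (arccos (Re (ip y x) / (norm y * norm x))))) | x y s.
     norm x = 1 \<and> y = T x \<and> s \<in> {1, -1}}"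

abbreviation real_SRG :: "('a::real_inner \<Rightarrow> 'a) \<Rightarrow> complex set" where
  "real_SRG T \<equiv> SRG (\<lambda>x y. complex_of_real (inner x y)) T"

abbreviation complex_SRG :: "('b::complex_inner \<Rightarrow> 'b) \<Rightarrow> complex set" where
  "complex_SRG T \<equiv> SRG cinner T"

definition is_complexification :: "('a::real_inner \<Rightarrow> 'b::complex_inner) \<Rightarrow> bool" where
  "is_complexification U \<longleftrightarrow>
     linear U \<and>
     (\<forall>x1 x2. cinner (U x1) (U x2) = complex_of_real (inner x1 x2)) \<and>
     (\<forall>y. \<exists>!p. y = U (fst p) + \<i> *\<^sub>C U (snd p))"

text \<open>
  For a complexification \<open>U\<close>, this determines \<open>TC\<close> uniquely; its complex linearity and
  boundedness follow from those of \<open>T\<close>.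
\<close>

definition is_complexification_of ::
  "('a::real_inner \<Rightarrow> 'b::complex_inner) \<Rightarrow> ('b \<Rightarrow> 'b) \<Rightarrow> ('a \<Rightarrow> 'a) \<Rightarrow> bool" where
  "is_complexification_of U TC T \<longleftrightarrow>
     (\<forall>x1 x2. TC (U x1 + \<i> *\<^sub>C U x2) = U (T x1) + \<i> *\<^sub>C U (T x2))"

lemma is_complexification_of_real:
  "is_complexification (of_real :: real \<Rightarrow> complex)"
proof -
  have "\<exists>!p. y = of_real (fst p) + \<i> *\<^sub>C of_real (snd p)" for y :: complex
    by (rule ex1I[of _ "(Re y, Im y)"]) (auto simp: scaleC_complex_def complex_eq_iff)
  moreover have "linear (of_real :: real \<Rightarrow> complex)"
    by (simp add: bounded_linear.linear bounded_linear_of_real)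
  ultimately show ?thesis
    by (simp add: is_complexification_def cinner_complex_def)
qed

end

theory Submission
  imports Defs
begin

text \<open>
  Up to conjugation a complex number \<open>z\<close> is determined by \<open>(Re z, |z|\<^sup>2)\<close>. In these coordinates the
  scaled relative graph of \<open>T\<close> is the joint range on the unit sphere of the quadratic forms
  \<open>\<langle>T x, x\<rangle>\<close> and \<open>|T x|\<^sup>2\<close>, and that of the complexification consists of all convex combinations of
  two points of this range. In dimension other than 2 the range is convex (Brickman's theorem), so
  both graphs agree. In dimension 2 the range is an ellipse, possibly degenerate, and the
  complexification fills it.
\<close>

section \<open>Common isotropic vectors of two quadratic forms\<close>

text \<open>\<open>B\<close> vanishes on the whole span of \<open>x\<close> and \<open>y\<close>, so
  any path in it stays isotropic. Along the segment from \<open>x\<close> to \<open>y\<close> the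
  form \<open>M\<close> passes from nonpositive to nonnegative, and independence keeps the segment
  away from 0.\<close>

lemma common_isotropic_vector_plane:
  fixes B M :: "'a::real_vector \<Rightarrow> 'a \<Rightarrow> real"
  assumes B: "bilinear B" "\<And>x y. B x y = B y x"
    and M: "bilinear M" "\<And>x y. M x y = M y x"
    and ind: "\<And>s r. s *\<^sub>R x + r *\<^sub>R y = 0 \<Longrightarrow> s = 0 \<and> r = 0"
    and "B x x = 0" "B y y = 0" "B x y = 0" "M x x \<le> 0" "M y y \<ge> 0"
  shows "\<exists>v. v \<noteq> 0 \<and> B v v = 0 \<and> M v v = 0"
proof -
  define c where "c t = (1 - t) *\<^sub>R x + t *\<^sub>R y" for t
  have Mc: "M (c t) (c t) = (1 - t)\<^sup>2 * M x x + 2 * (1 - t) * t * M x y + t\<^sup>2 * M y y" for t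
    using M(2)[of y x]
    by (simp add: c_def bilinear_ladd[OF M(1)] bilinear_radd[OF M(1)] bilinear_lmul[OF M(1)]
        bilinear_rmul[OF M(1)]) (simp add: algebra_simps power2_eq_square)
  have Bc: "B (c t) (c t) = 0" for t
    using B(2)[of y x] assms(6-8)
    by (simp add: c_def bilinear_ladd[OF B(1)] bilinear_radd[OF B(1)] bilinear_lmul[OF B(1)]
        bilinear_rmul[OF B(1)])
  have "continuous_on {0..1} (\<lambda>t. M (c t) (c t))"
    unfolding Mc by (intro continuous_intros)
  then have "\<exists>t\<ge>0. t \<le> 1 \<and> M (c t) (c t) = 0"
    using assms(9,10) by (intro IVT') (auto simp: c_def)
  then obtain t where t: "M (c t) (c t) = 0" by blast
  moreover have "c t \<noteq> 0"
    using ind[of "1 - t" t] by (auto simp: c_def)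
  ultimately show ?thesis using Bc by blast
qed

text \<open>
  The isotropic cone of \<open>B\<close> in three-dimensional space is connected up to sign, so that some
  polynomial path in it leads from \<open>x\<close> to a multiple of \<open>y\<close>. This fails in the plane.
\<close>

lemma common_isotropic_vector_space:
  fixes B M :: "'a::real_vector \<Rightarrow> 'a \<Rightarrow> real"
  assumes B: "bilinear B" "\<And>x y. B x y = B y x"
    and M: "bilinear M" "\<And>x y. M x y = M y x"
    and ind: "\<And>s r w. s *\<^sub>R x + r *\<^sub>R y + w *\<^sub>R e = 0 \<Longrightarrow> s = 0 \<and> r = 0 \<and> w = 0"
    and xy: "B x x = 0" "B y y = 0" "M x x \<le> 0" "M y y \<ge> 0"
  shows "\<exists>v. v \<noteq> 0 \<and> B v v = 0 \<and> M v v = 0"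
proof (cases "B x y = 0")
  case True
  show ?thesis
  proof (rule common_isotropic_vector_plane[OF B M _ xy(1,2) True xy(3,4)])
    show "s = 0 \<and> r = 0" if "s *\<^sub>R x + r *\<^sub>R y = 0" for s r
      using ind[of s r 0] that by simp
  qed
next
  case False
  \<comment> \<open>\<open>d\<close> is \<open>e\<close> made \<open>B\<close>-orthogonal to
    \<open>x\<close> and \<open>y\<close>. In coordinates p, q, r along \<open>x\<close>,
    \<open>y\<close>, \<open>d\<close> the cone is 2pq \<open>B x y\<close> + r^2
    \<open>B d d\<close> = 0, that is, pq = k r^2 for the \<open>k\<close> below.\<close>
  define d where "d = e - (B e y / B x y) *\<^sub>R x - (B e x / B x y) *\<^sub>R y"
  have Bxd: "B x d = 0" and Bdy: "B d y = 0"
    using xy False B(2)[of y x] B(2)[of x e]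
    by (simp_all add: d_def bilinear_lsub[OF B(1)] bilinear_rsub[OF B(1)]
        bilinear_lmul[OF B(1)] bilinear_rmul[OF B(1)])
  have indd: "s = 0 \<and> r = 0 \<and> w = 0" if "s *\<^sub>R x + r *\<^sub>R y + w *\<^sub>R d = 0" for s r w
  proof -
    have "(s - w * (B e y / B x y)) *\<^sub>R x + (r - w * (B e x / B x y)) *\<^sub>R y + w *\<^sub>R e = 0"
      using that by (simp add: d_def algebra_simps)
    from ind[OF this] show ?thesis by auto
  qed
  define k where "k = - B d d / (2 * B x y)"
  show ?thesis
  proof (cases "k = 0")
    case True
    then have Bdd: "B d d = 0"
      using False by (simp add: k_def)
    \<comment> \<open>\<open>B\<close> vanishes on the span of \<open>x\<close> and \<open>d\<close>
      and on that of \<open>d\<close> and \<open>y\<close>; the sign of \<open>M d d\<close> decides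
      on which of the two \<open>M\<close> changes sign.\<close>
    show ?thesis
    proof (cases "M d d \<ge> 0")
      case True
      show ?thesis
      proof (rule common_isotropic_vector_plane[OF B M _ xy(1) Bdd Bxd xy(3) True])
        show "s = 0 \<and> r = 0" if "s *\<^sub>R x + r *\<^sub>R d = 0" for s r
          using indd[of s 0 r] that by simp
      qed
    next
      case False
      then have "M d d \<le> 0" by simp
      show ?thesis
      proof (rule common_isotropic_vector_plane[OF B M _ Bdd xy(2) Bdy \<open>M d d \<le> 0\<close> xy(4)])
        show "s = 0 \<and> r = 0" if "s *\<^sub>R d + r *\<^sub>R y = 0" for s r
          using indd[of 0 r s] that by (simp add: add.commute)
      qed
    qed
  next
    case k: False
    \<comment> \<open>A parametrisation of the cone pq = k r^2, leading from \<open>x\<close> at t =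
      0 to \<open>k *\<^sub>R y\<close> at t = 1, where \<open>M\<close> is still nonnegative. The
      coefficients of \<open>x\<close> and \<open>y\<close> never vanish together.\<close>
    define c where "c t = (1 - t)\<^sup>2 *\<^sub>R x + (k * t\<^sup>2) *\<^sub>R y + ((1 - t) * t) *\<^sub>R d" for t
    have expand: "F (c t) (c t) = (1 - t)^4 * F x x + k\<^sup>2 * t^4 * F y y + (1 - t)\<^sup>2 * t\<^sup>2 * F d d
        + 2 * k * (1 - t)\<^sup>2 * t\<^sup>2 * F x y + 2 * (1 - t)^3 * t * F x d + 2 * k * (1 - t) * t^3 * F d y"
      if F: "bilinear F" "\<And>x y. F x y = F y x" for F :: "'a \<Rightarrow> 'a \<Rightarrow> real" and t
    proof -
      have gen: "F (p *\<^sub>R x + q *\<^sub>R y + r *\<^sub>R d) (p *\<^sub>R x + q *\<^sub>R y + r *\<^sub>R d) =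
          p\<^sup>2 * F x x + q\<^sup>2 * F y y + r\<^sup>2 * F d d
          + 2 * p * q * F x y + 2 * p * r * F x d + 2 * q * r * F d y" for p q r
        using F(2)[of y x] F(2)[of d x] F(2)[of y d]
        by (simp add: bilinear_ladd[OF F(1)] bilinear_radd[OF F(1)] bilinear_lmul[OF F(1)]
            bilinear_rmul[OF F(1)]) (simp add: algebra_simps power2_eq_square)
      show ?thesis
        unfolding c_def gen by algebra
    qed
    have Bc: "B (c t) (c t) = 0" for t
      unfolding expand[OF B] using xy Bxd Bdy False
      by (simp add: k_def field_simps)
    have "continuous_on {0..1} (\<lambda>t. M (c t) (c t))"
      unfolding expand[OF M] by (intro continuous_intros)
    then have "\<exists>t\<ge>0. t \<le> 1 \<and> M (c t) (c t) = 0"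
      using xy by (intro IVT') (auto simp: expand[OF M])
    then obtain t where t: "M (c t) (c t) = 0" by blast
    moreover have "c t \<noteq> 0"
      using indd[of "(1 - t)\<^sup>2" "k * t\<^sup>2" "(1 - t) * t"] k by (auto simp: c_def)
    ultimately show ?thesis using Bc by blast
  qed
qed

text \<open>The pairs of values of \<open>f\<close> and \<open>g\<close> at \<open>y1\<close> and at
  \<open>y2\<close> are opposite points of the plane. Turning the plane (up to scaling) puts both on
  one axis: the new form \<open>B\<close> vanishes at \<open>y1\<close> and \<open>y2\<close>, while
  \<open>M\<close> takes opposite values there. Proportional vectors have values on a common ray, so
  \<open>y1\<close> and \<open>y2\<close> are independent, and dimension other than 2 leaves room
  for a third direction.\<close>

lemma common_isotropic_vector:
  fixes f g :: "'a::real_vector \<Rightarrow> 'a \<Rightarrow> real"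
  assumes dim: "dim (UNIV :: 'a set) \<noteq> 2"
    and f: "bilinear f" "\<And>x y. f x y = f y x"
    and g: "bilinear g" "\<And>x y. g x y = g y x"
    and nz: "y1 \<noteq> 0 \<or> y2 \<noteq> 0"
    and sums: "f y1 y1 + f y2 y2 = 0" "g y1 y1 + g y2 y2 = 0"
  shows "\<exists>v. v \<noteq> 0 \<and> f v v = 0 \<and> g v v = 0"
proof (cases "f y1 y1 = 0 \<and> g y1 y1 = 0")
  case True
  then show ?thesis using nz sums by auto
next
  case False
  define F G where "F = f y1 y1" and "G = g y1 y1"
  have FG: "F\<^sup>2 + G\<^sup>2 > 0" and F2: "f y2 y2 = - F" and G2: "g y2 y2 = - G"
    using False sums by (auto simp: F_def G_def sum_power2_gt_zero_iff)
  have mult: "y2 \<noteq> c *\<^sub>R y1" for c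
  proof
    assume "y2 = c *\<^sub>R y1"
    then have "c\<^sup>2 * F = - F" "c\<^sup>2 * G = - G"
      using F2 G2
      by (simp_all add: F_def G_def bilinear_lmul[OF f(1)] bilinear_rmul[OF f(1)]
          bilinear_lmul[OF g(1)] bilinear_rmul[OF g(1)] power2_eq_square)
    then have "(c\<^sup>2 + 1) * F = 0" "(c\<^sup>2 + 1) * G = 0"
      by (simp_all add: algebra_simps)
    moreover have "c\<^sup>2 + 1 \<noteq> 0"
      using zero_le_power2[of c] by linarith
    ultimately show False using FG by simp
  qed
  have y1: "y1 \<noteq> 0"
    using False bilinear_lzero[OF f(1)] bilinear_lzero[OF g(1)] by auto
  have "y1 \<noteq> y2" using mult[of 1] by auto
  moreover have "independent {y1, y2}"
    using y1 mult by (auto simp: independent_insert insert_commute[of y1] span_singleton)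
  \<comment> \<open>This covers infinite dimension too, where \<open>dim\<close> has the default
    value 0.\<close>
  ultimately have "span {y1, y2} \<noteq> UNIV"
    using dim dim_eq_card[of "{y1, y2}" UNIV] by auto
  then obtain e where e: "e \<notin> span {y1, y2}" by auto
  define B M where "B x y = G * f x y - F * g x y" and "M x y = - F * f x y - G * g x y" for x y
  have "\<exists>v. v \<noteq> 0 \<and> B v v = 0 \<and> M v v = 0"
  proof (rule common_isotropic_vector_space[where B = B and M = M and x = y1 and y = y2 and e = e])
    show "bilinear B" "bilinear M"
      using f(1) g(1)
      by (auto simp: bilinear_def linear_iff B_def M_def algebra_simps)
    show "B x y = B y x" "M x y = M y x" for x y
      using f(2)[of x y] g(2)[of x y] by (simp_all add: B_def M_def)
    show "B y1 y1 = 0" "B y2 y2 = 0" "M y1 y1 \<le> 0" "M y2 y2 \<ge> 0"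
      using FG by (auto simp: B_def M_def F2 G2 power2_eq_square simp flip: F_def G_def)
    show "s = 0 \<and> r = 0 \<and> w = 0" if 0: "s *\<^sub>R y1 + r *\<^sub>R y2 + w *\<^sub>R e = 0" for s r w
    proof -
      have "w = 0"
      proof (rule ccontr)
        assume "w \<noteq> 0"
        have "w *\<^sub>R e = - (s *\<^sub>R y1 + r *\<^sub>R y2)"
          using 0 by (simp add: add_eq_0_iff)
        moreover have "- (s *\<^sub>R y1 + r *\<^sub>R y2) \<in> span {y1, y2}"
          by (intro span_neg span_add span_scale span_base) auto
        ultimately have "w *\<^sub>R e \<in> span {y1, y2}" by simp
        from span_scale[OF this, of "1 / w"] show False
          using e \<open>w \<noteq> 0\<close> by simp
      qed
      moreover have "r = 0"
      proof (rule ccontr)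
        assume "r \<noteq> 0"
        have "r *\<^sub>R y2 = (- s) *\<^sub>R y1"
          using 0 \<open>w = 0\<close> by (simp add: add_eq_0_iff)
        then have "(1 / r) *\<^sub>R r *\<^sub>R y2 = (1 / r) *\<^sub>R (- s) *\<^sub>R y1" by (rule arg_cong)
        then show False
          using \<open>r \<noteq> 0\<close> mult[of "- s / r"] by simp
      qed
      ultimately show ?thesis using 0 y1 by simp
    qed
  qed
  then obtain v where v: "v \<noteq> 0" "B v v = 0" "M v v = 0" by blast
  \<comment> \<open>Turning back: up to the positive factor, \<open>f\<close> and \<open>g\<close>
    are combinations of \<open>B\<close> and \<open>M\<close>.\<close>
  have "(F\<^sup>2 + G\<^sup>2) * f v v = G * B v v - F * M v v" "(F\<^sup>2 + G\<^sup>2) * g v v = - F * B v v - G * M v v"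
    by (simp_all add: B_def M_def algebra_simps power2_eq_square)
  then show ?thesis using v FG by auto
qed

section \<open>Scaled relative graphs in terms of quadratic forms\<close>

text \<open>The two signs give a conjugate pair, which is determined by its real part and modulus.
  The hypothesis is the Cauchy-Schwarz inequality, which keeps the argument of \<open>arccos\<close>
  in [-1, 1]; with \<open>ip\<close> left open, it serves real and complex spaces alike.\<close>

lemma SRG_iff:
  assumes "\<And>x. \<bar>Re (ip (T x) x)\<bar> \<le> norm (T x) * norm x"
  shows "z \<in> SRG ip T \<longleftrightarrow>
    (\<exists>x. norm x = 1 \<and> Re z = Re (ip (T x) x) \<and> (cmod z)\<^sup>2 = (norm (T x))\<^sup>2)"
proof -
  have "(\<exists>s\<in>{1, -1}. z = complex_of_real (norm (T x) / norm x) *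
         exp (s * (\<i> * complex_of_real (arccos (Re (ip (T x) x) / (norm (T x) * norm x)))))) \<longleftrightarrow>
       Re z = Re (ip (T x) x) \<and> (cmod z)\<^sup>2 = (norm (T x))\<^sup>2" (is "?L \<longleftrightarrow> ?R")
    if x: "norm x = 1" for x
  proof -
    define a n where "a = Re (ip (T x) x)" and "n = norm (T x)"
    have an: "\<bar>a\<bar> \<le> n" and n: "n \<ge> 0"
      using assms[of x] x by (simp_all add: a_def n_def)
    have L: "?L \<longleftrightarrow> z = of_real n * cis (arccos (a / n)) \<or> z = of_real n * cis (- arccos (a / n))"
      by (simp add: x cis_conv_exp flip: a_def n_def)
    have R: "?R \<longleftrightarrow> Re z = a \<and> (Im z)\<^sup>2 = n\<^sup>2 - a\<^sup>2"
      unfolding a_def[symmetric] n_def[symmetric] cmod_power2 by auto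
    \<comment> \<open>If n = 0, then a = 0 as well, and the value of the quotient a / 0 is
      immaterial.\<close>
    have c: "n * cos (arccos (a / n)) = a"
    proof (cases "n = 0")
      case False
      then have "\<bar>a / n\<bar> \<le> 1" using an n by (simp add: divide_le_eq)
      then show ?thesis using False by (simp add: cos_arccos_abs)
    qed (use an in auto)
    then have s: "(n * sin (arccos (a / n)))\<^sup>2 = n\<^sup>2 - a\<^sup>2"
      by (metis (no_types, lifting) power_mult_distrib right_diff_distrib mult.right_neutral sin_squared_eq)
    show ?thesis
      unfolding L R unfolding s[symmetric] power2_eq_iff using c by (auto simp: complex_eq_iff)
  qed
  then show ?thesis
    unfolding SRG_def by blast
qed

lemma real_SRG_iff:
  fixes T :: "'a::real_inner \<Rightarrow> 'a"
  shows "z \<in> real_SRG T \<longleftrightarrow>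
    (\<exists>x. norm x = 1 \<and> Re z = inner (T x) x \<and> (cmod z)\<^sup>2 = (norm (T x))\<^sup>2)"
  by (subst SRG_iff) (auto simp: Cauchy_Schwarz_ineq2)

text \<open>Writing vectors as \<open>U x + \<i> *\<^sub>C U y\<close> turns the real part of
  \<open>cinner\<close> into the inner product of \<open>'a \<times> 'a\<close>. Norms and
  Cauchy-Schwarz carry over from that product, and all quantities split into sums over
  \<open>x\<close> and \<open>y\<close>.\<close>

lemma complex_SRG_iff:
  fixes T :: "'a::real_inner \<Rightarrow> 'a" and U :: "'a \<Rightarrow> 'b::complex_inner"
  assumes U: "is_complexification U" and TC: "is_complexification_of U TC T"
  shows "z \<in> complex_SRG TC \<longleftrightarrow>
    (\<exists>x y. (norm x)\<^sup>2 + (norm y)\<^sup>2 = 1 \<and> Re z = inner (T x) x + inner (T y) y \<and>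
      (cmod z)\<^sup>2 = (norm (T x))\<^sup>2 + (norm (T y))\<^sup>2)"
proof -
  define E where "E x y = U x + \<i> *\<^sub>C U y" for x y
  have surj: "\<exists>x y. v = E x y" for v
    using U unfolding is_complexification_def E_def by blast
  have TCE: "TC (E x y) = E (T x) (T y)" for x y
    using TC by (simp add: is_complexification_of_def E_def)
  have cU: "cinner (U x) (U y) = complex_of_real (inner x y)" for x y
    using U by (simp add: is_complexification_def)
  have add_right: "cinner u (v + w) = cinner u v + cinner u w" for u v w :: 'b
    using cinner_commute[of u "v + w"] cinner_commute[of u v] cinner_commute[of u w]
    by (simp add: cinner_add_left)
  have scale_right: "cinner u (a *\<^sub>C v) = cnj a * cinner u v" for u v :: 'b and a
    using cinner_commute[of u "a *\<^sub>C v"] cinner_commute[of u v]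
    by (simp add: cinner_scaleC_left)
  have Re_E: "Re (cinner (E x y) (E x' y')) = inner (x, y) (x', y')" for x y x' y'
    by (simp add: E_def cinner_add_left add_right cinner_scaleC_left scale_right cU)
  have norm_E: "norm (E x y) = norm (x, y)" for x y
    by (simp add: norm_eq_sqrt_cinner Re_E norm_eq_sqrt_inner[where 'a = "'a \<times> 'a"])
  have CS: "\<bar>Re (cinner u v)\<bar> \<le> norm u * norm v" for u v :: 'b
    using surj[of u] surj[of v] by (auto simp: Re_E norm_E Cauchy_Schwarz_ineq2 simp del: inner_Pair)
  have ex: "(\<exists>v. P v) \<longleftrightarrow> (\<exists>x y. P (E x y))" for P
    using surj by metis
  show ?thesis
    by (subst SRG_iff, rule CS, subst ex) (simp add: TCE Re_E norm_E norm_Pair)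
qed

lemma real_SRG_subset_complex_SRG:
  fixes T :: "'a::real_inner \<Rightarrow> 'a" and U :: "'a \<Rightarrow> 'b::complex_inner"
  assumes T: "linear T" and "is_complexification U" "is_complexification_of U TC T"
  shows "real_SRG T \<subseteq> complex_SRG TC"
proof
  fix z assume "z \<in> real_SRG T"
  then obtain x where "norm x = 1" "Re z = inner (T x) x" "(cmod z)\<^sup>2 = (norm (T x))\<^sup>2"
    unfolding real_SRG_iff by blast
  then show "z \<in> complex_SRG TC"
    unfolding complex_SRG_iff[OF assms(2,3)]
    by (intro exI[of _ x] exI[of _ 0]) (simp add: linear_0[OF T])
qed

text \<open>These polarise \<open>inner (T x) x\<close> and \<open>(norm (T x))\<^sup>2\<close>,
  each minus a multiple of \<open>(norm x)\<^sup>2\<close>. The first is symmetrised because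
  \<open>T\<close> need not be self-adjoint.\<close>

lemma bilinear_shifted_forms:
  fixes T :: "'a::real_inner \<Rightarrow> 'a"
  assumes "linear T"
  shows "bilinear (\<lambda>x y. (inner (T x) y + inner (T y) x) / 2 - a * inner x y)"
    and "bilinear (\<lambda>x y. inner (T x) (T y) - a * inner x y)"
  using assms
  by (auto simp: bilinear_def linear_iff inner_add_left inner_add_right algebra_simps
      add_divide_distrib)

text \<open>Subtracting the target values times the squared norm makes the conditions on a unit
  vector homogeneous: any common isotropic vector of \<open>f\<close> and \<open>g\<close>, once
  normalised, represents \<open>z\<close>. The pair \<open>x\<close>, \<open>y\<close> that
  represents \<open>z\<close> in the complexification has form values adding up to 0.\<close>

lemma complex_SRG_subset_real_SRG:
  fixes T :: "'a::real_inner \<Rightarrow> 'a" and U :: "'a \<Rightarrow> 'b::complex_inner"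
  assumes T: "linear T" and "is_complexification U" "is_complexification_of U TC T"
    and dim: "dim (UNIV :: 'a set) \<noteq> 2"
  shows "complex_SRG TC \<subseteq> real_SRG T"
proof
  fix z assume "z \<in> complex_SRG TC"
  then obtain x y where xy: "(norm x)\<^sup>2 + (norm y)\<^sup>2 = 1" "Re z = inner (T x) x + inner (T y) y"
      "(cmod z)\<^sup>2 = (norm (T x))\<^sup>2 + (norm (T y))\<^sup>2"
    unfolding complex_SRG_iff[OF assms(2,3)] by blast
  define f where "f = (\<lambda>u v. (inner (T u) v + inner (T v) u) / 2 - Re z * inner u v)"
  define g where "g = (\<lambda>u v. inner (T u) (T v) - (cmod z)\<^sup>2 * inner u v)"
  have "\<exists>v. v \<noteq> 0 \<and> f v v = 0 \<and> g v v = 0"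
  proof (rule common_isotropic_vector[OF dim, where f = f and g = g and ?y1.0 = x and ?y2.0 = y])
    show "bilinear f" "bilinear g"
      using bilinear_shifted_forms[OF T] by (simp_all add: f_def g_def)
    show "f u v = f v u" "g u v = g v u" for u v
      by (simp_all add: f_def g_def inner_commute)
    show "x \<noteq> 0 \<or> y \<noteq> 0" using xy(1) by auto
    have "f x x + f y y = inner (T x) x + inner (T y) y - Re z * ((norm x)\<^sup>2 + (norm y)\<^sup>2)"
      by (simp add: f_def power2_norm_eq_inner algebra_simps)
    then show "f x x + f y y = 0" using xy by simp
    have "g x x + g y y =
        (norm (T x))\<^sup>2 + (norm (T y))\<^sup>2 - (cmod z)\<^sup>2 * ((norm x)\<^sup>2 + (norm y)\<^sup>2)"
      by (simp add: g_def power2_norm_eq_inner algebra_simps)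
    then show "g x x + g y y = 0" using xy by simp
  qed
  then obtain v where v: "v \<noteq> 0" "inner (T v) v = Re z * (norm v)\<^sup>2"
      "(norm (T v))\<^sup>2 = (cmod z)\<^sup>2 * (norm v)\<^sup>2"
    by (auto simp: f_def g_def power2_norm_eq_inner)
  then show "z \<in> real_SRG T"
    unfolding real_SRG_iff
    by (intro exI[of _ "v /\<^sub>R norm v"])
      (simp add: linear_scale[OF T] power_mult_distrib power_divide field_simps power2_eq_square)
qed

section \<open>The boundary of a filled ellipse in the coordinates \<open>(Re z, |z|\<^sup>2)\<close>\<close>

text \<open>In the plane of (Re z, |z|^2), the ellipse has centre (M1, M2) and is spanned by the
  vectors (U1, U2) and (V1, V2), which may be dependent. \<open>curve\<close> and
  \<open>region\<close> are the preimages of the ellipse and of the filled ellipse in the complex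
  plane.\<close>

locale ellipse =
  fixes M1 U1 V1 M2 U2 V2 :: real
begin

definition curve :: "complex set" where
  "curve = {z. \<exists>w. cmod w = 1 \<and> Re z = M1 + U1 * Re w + V1 * Im w \<and>
     (cmod z)\<^sup>2 = M2 + U2 * Re w + V2 * Im w}"

definition region :: "complex set" where
  "region = {z. \<exists>w. cmod w \<le> 1 \<and> Re z = M1 + U1 * Re w + V1 * Im w \<and>
     (cmod z)\<^sup>2 = M2 + U2 * Re w + V2 * Im w}"

lemma curve_subset_region: "curve \<subseteq> region"
  unfolding curve_def region_def by (blast intro: eq_refl)

lemma closed_region: "closed region"
proof -
  define L where "L w = (M1 + U1 * Re w + V1 * Im w, M2 + U2 * Re w + V2 * Im w)" for w
  have "compact (L ` cball 0 1)"
    unfolding L_def by (intro compact_continuous_image continuous_intros compact_cball)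
  then have "closed ((\<lambda>z. (Re z, (cmod z)\<^sup>2)) -` (L ` cball 0 1))"
    by (intro closed_vimage compact_imp_closed continuous_intros)
  moreover have "(\<lambda>z. (Re z, (cmod z)\<^sup>2)) -` (L ` cball 0 1) = region"
    unfolding vimage_def image_iff L_def region_def Bex_def mem_cball_0 prod.inject by simp
  ultimately show ?thesis by simp
qed

text \<open>If the affine map from the disc were degenerate, its parameter \<open>w\<close> could be
  moved along the kernel to the unit circle, putting \<open>z\<close> on the curve. Hence it is
  invertible, and the parameter depends continuously on \<open>z\<close>, so it stays inside the
  open disc nearby.\<close>

lemma region_subset_interior_or_curve:
  assumes "z \<in> region" "z \<notin> curve"
  shows "z \<in> interior region"
proof -
  obtain w where w: "cmod w \<le> 1" "Re z = M1 + U1 * Re w + V1 * Im w"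
      "(cmod z)\<^sup>2 = M2 + U2 * Re w + V2 * Im w"
    using assms(1) unfolding region_def by blast
  have w1: "cmod w < 1"
    using w assms(2) unfolding curve_def by (cases "cmod w = 1") auto
  define D where "D = U1 * V2 - U2 * V1"
  have D: "D \<noteq> 0"
  proof
    assume D0: "D = 0"
    obtain n where n: "n \<noteq> 0" "U1 * Re n + V1 * Im n = 0" "U2 * Re n + V2 * Im n = 0"
    proof (cases "U1 = 0 \<and> V1 = 0")
      case True
      then show ?thesis
        using that[of 1] that[of "Complex V2 (- U2)"] by (cases "U2 = 0 \<and> V2 = 0") (auto simp: complex_eq_iff)
    next
      case False
      then show ?thesis
        using that[of "Complex V1 (- U1)"] D0 by (auto simp: complex_eq_iff D_def mult.commute)
    qed
    \<comment> \<open>The step has length 2, enough to leave the disc from any interior point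
      \<open>w\<close>.\<close>
    define t where "t = 2 / cmod n"
    have "2 - cmod w \<le> cmod (w + t *\<^sub>R n)"
      using norm_triangle_ineq4[of "w + t *\<^sub>R n" w] n(1) by (simp add: t_def)
    then have "\<exists>s\<ge>0. s \<le> t \<and> cmod (w + s *\<^sub>R n) = 1"
      using w1 by (intro IVT' continuous_intros) (auto simp: t_def)
    then obtain s where "cmod (w + s *\<^sub>R n) = 1" by blast
    moreover have "U1 * Re (w + s *\<^sub>R n) + V1 * Im (w + s *\<^sub>R n) =
        U1 * Re w + V1 * Im w + s * (U1 * Re n + V1 * Im n)"
      "U2 * Re (w + s *\<^sub>R n) + V2 * Im (w + s *\<^sub>R n) =
        U2 * Re w + V2 * Im w + s * (U2 * Re n + V2 * Im n)"
      by (simp_all add: algebra_simps)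
    ultimately have "z \<in> curve"
      unfolding curve_def using w n by (auto intro!: exI[of _ "w + s *\<^sub>R n"] simp: add.assoc)
    with assms(2) show False by blast
  qed
  \<comment> \<open>Cramer's rule for the parameter belonging to \<open>z\<close>.\<close>
  define W where "W z = Complex (((Re z - M1) * V2 - ((cmod z)\<^sup>2 - M2) * V1) / D)
      ((((cmod z)\<^sup>2 - M2) * U1 - (Re z - M1) * U2) / D)" for z
  have W: "Re z = M1 + U1 * Re (W z) + V1 * Im (W z)"
      "(cmod z)\<^sup>2 = M2 + U2 * Re (W z) + V2 * Im (W z)" for z
    using D by (simp_all add: W_def divide_simps) (simp_all add: D_def algebra_simps)
  have "D * Re (W z) = D * Re w" "D * Im (W z) = D * Im w"
    using D unfolding W_def w(2,3) by (simp_all, simp_all add: D_def algebra_simps)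
  then have "W z = w"
    using D by (simp add: complex_eq_iff)
  moreover have "open {z. cmod (W z) < 1}"
    unfolding W_def Complex_eq using D by (intro open_Collect_less continuous_intros) auto
  moreover have "{z. cmod (W z) < 1} \<subseteq> region"
    unfolding region_def using W by (blast intro: less_imp_le)
  ultimately show ?thesis
    using w1 by (intro interiorI) auto
qed

text \<open>This is a supporting line of the filled ellipse at the image of \<open>w0\<close>. A
  degenerate ellipse lies on a line, so some nonzero functional is constant on it. Otherwise the
  functional is chosen to pull back to a positive multiple of \<open>inner w0\<close>, which is
  maximal on the disc at \<open>w0\<close>.\<close>

lemma support_functional:
  assumes "cmod w0 = 1"
  obtains \<alpha> \<beta> :: real where "\<alpha> \<noteq> 0 \<or> \<beta> \<noteq> 0"
    and "\<And>w. cmod w \<le> 1 \<Longrightarrow>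
      \<alpha> * (U1 * Re w + V1 * Im w) + \<beta> * (U2 * Re w + V2 * Im w)
      \<le> \<alpha> * (U1 * Re w0 + V1 * Im w0) + \<beta> * (U2 * Re w0 + V2 * Im w0)"
proof -
  define D where "D = U1 * V2 - U2 * V1"
  have nz: "Re w0 \<noteq> 0 \<or> Im w0 \<noteq> 0"
    using assms cmod_power2[of w0] by auto
  show ?thesis
  proof (cases "D = 0")
    case True
    obtain \<alpha> \<beta> where "\<alpha> \<noteq> 0 \<or> \<beta> \<noteq> 0" "\<alpha> * U1 + \<beta> * U2 = 0" "\<alpha> * V1 + \<beta> * V2 = 0"
    proof (cases "U1 = 0 \<and> U2 = 0")
      case U: True
      then show ?thesis
        using that[of 1 0] that[of V2 "- V1"] by (cases "V1 = 0 \<and> V2 = 0") auto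
    next
      case False
      then show ?thesis
        using that[of U2 "- U1"] True by (auto simp: D_def)
    qed
    moreover have "\<alpha> * (U1 * p + V1 * q) + \<beta> * (U2 * p + V2 * q) =
        (\<alpha> * U1 + \<beta> * U2) * p + (\<alpha> * V1 + \<beta> * V2) * q" for p q
      by (simp add: algebra_simps)
    ultimately show ?thesis
      by (intro that[of \<alpha> \<beta>]) auto
  next
    case False
    \<comment> \<open>Solves the linear system for the pullback. The factor \<open>D\<close> in
      place of \<open>1 / D\<close> avoids division and makes the multiple the positive number
      \<open>D\<^sup>2\<close>.\<close>
    define \<alpha> \<beta> where "\<alpha> = D * (Re w0 * V2 - Im w0 * U2)" and "\<beta> = D * (Im w0 * U1 - Re w0 * V1)"
    have eq: "\<alpha> * (U1 * p + V1 * q) + \<beta> * (U2 * p + V2 * q) = D\<^sup>2 * (Re w0 * p + Im w0 * q)" for p q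
      by (simp add: \<alpha>_def \<beta>_def D_def power2_eq_square algebra_simps)
    show ?thesis
    proof (rule that[of \<alpha> \<beta>])
      have "D\<^sup>2 * (Re w0 * Re w0 + Im w0 * Im w0) \<noteq> 0"
        using False nz by (simp add: sum_squares_eq_zero_iff)
      then show "\<alpha> \<noteq> 0 \<or> \<beta> \<noteq> 0"
        unfolding eq[symmetric] by auto
      fix w assume w: "cmod w \<le> 1"
      have "Re w0 * Re w + Im w0 * Im w = inner w0 w"
        by (simp add: inner_complex_def)
      also have "\<dots> \<le> cmod w0 * cmod w"
        by (rule norm_cauchy_schwarz)
      also have "\<dots> \<le> 1" using assms w by simp
      also have "1 = Re w0 * Re w0 + Im w0 * Im w0"
        using cmod_power2[of w0] assms by (simp add: power2_eq_square)
      finally show "\<alpha> * (U1 * Re w + V1 * Im w) + \<beta> * (U2 * Re w + V2 * Im w)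
          \<le> \<alpha> * (U1 * Re w0 + V1 * Im w0) + \<beta> * (U2 * Re w0 + V2 * Im w0)"
        unfolding eq by (intro mult_left_mono) auto
    qed
  qed
qed

text \<open>
  At a non-real point \<open>z \<mapsto> (Re z, |z|\<^sup>2)\<close> is a local diffeomorphism, so a supporting line of the
  ellipse excludes \<open>z\<close> from the interior. On the real axis, the fold of this map, that argument
  breaks down at a tangent of the parabola; there the finiteness assumption is needed.
\<close>

lemma curve_disjoint_interior:
  assumes fin: "finite {x. complex_of_real x \<in> region}" and z: "z \<in> curve"
  shows "z \<notin> interior region"
proof
  assume "z \<in> interior region"
  then obtain d where d: "d > 0" "ball z d \<subseteq> region"
    unfolding mem_interior by blast
  obtain w0 where w0: "cmod w0 = 1" "Re z = M1 + U1 * Re w0 + V1 * Im w0"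
      "(cmod z)\<^sup>2 = M2 + U2 * Re w0 + V2 * Im w0"
    using z unfolding curve_def by blast
  show False
  proof (cases "Im z = 0")
    case True
    \<comment> \<open>A real interior point would bring a whole interval of real points into the
      region.\<close>
    have "{Re z<..<Re z + d} \<subseteq> {x. complex_of_real x \<in> region}"
    proof
      fix x assume x: "x \<in> {Re z<..<Re z + d}"
      have "z - of_real x = of_real (Re z - x)"
        using True by (simp add: complex_eq_iff)
      then have "dist z (of_real x) = \<bar>Re z - x\<bar>"
        by (simp only: dist_norm norm_of_real)
      then have "of_real x \<in> ball z d"
        using x by simp
      then show "x \<in> {x. complex_of_real x \<in> region}"
        using d by auto
    qed
    then have "finite {Re z<..<Re z + d}"
      using fin by (rule finite_subset)
    then show False
      using d(1) by (simp add: infinite_Ioo)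
  next
    case False
    obtain \<alpha> \<beta> where ab: "\<alpha> \<noteq> 0 \<or> \<beta> \<noteq> 0"
      and supp: "\<And>w. cmod w \<le> 1 \<Longrightarrow>
        \<alpha> * (U1 * Re w + V1 * Im w) + \<beta> * (U2 * Re w + V2 * Im w)
        \<le> \<alpha> * (U1 * Re w0 + V1 * Im w0) + \<beta> * (U2 * Re w0 + V2 * Im w0)"
      using support_functional[OF w0(1)] by blast
    have max: "\<alpha> * Re v + \<beta> * (cmod v)\<^sup>2 \<le> \<alpha> * Re z + \<beta> * (cmod z)\<^sup>2" if "v \<in> ball z d" for v
    proof -
      from that d obtain w where "cmod w \<le> 1" "Re v = M1 + U1 * Re w + V1 * Im w"
          "(cmod v)\<^sup>2 = M2 + U2 * Re w + V2 * Im w"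
        unfolding region_def by blast
      then show ?thesis
        using supp[of w] w0 by (simp add: algebra_simps)
    qed
    \<comment> \<open>A vertical move fixes Re z, so it tests the coefficient of |z|^2
      alone.\<close>
    have imag: "\<beta> * (2 * Im z * k + k\<^sup>2) \<le> 0" if "\<bar>k\<bar> < d" for k
    proof -
      have "z + \<i> * of_real k \<in> ball z d"
        using that by (simp add: dist_norm norm_mult)
      from max[OF this] show ?thesis
        by (simp add: cmod_power2) (simp add: power2_eq_square algebra_simps)
    qed
    \<comment> \<open>With the sign of Im z and size at most |Im z|, moving by \<open>k\<close>
      increases |z|^2 and moving by \<open>- k\<close> decreases it. Both are possible within the
      ball, which forces \<open>\<beta> = 0\<close>.\<close>
    define k where "k = min (d / 2) \<bar>Im z\<bar> * sgn (Im z)"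
    have k: "\<bar>k\<bar> < d" "\<bar>k\<bar> \<le> \<bar>Im z\<bar>" "k * Im z > 0" "k \<noteq> 0"
      using d(1) False by (auto simp: k_def abs_mult abs_sgn_eq sgn_if zero_less_mult_iff mult_less_0_iff)
    have "k\<^sup>2 \<le> k * Im z"
      using k mult_left_mono[OF k(2), of "\<bar>k\<bar>"]
      by (simp add: power2_eq_square abs_mult[symmetric])
    moreover have "k\<^sup>2 > 0" using k by simp
    moreover have "2 * Im z * k = 2 * (k * Im z)" "2 * Im z * (- k) = - 2 * (k * Im z)"
      by simp_all
    ultimately have "2 * Im z * k + k\<^sup>2 > 0" "2 * Im z * (- k) + (- k)\<^sup>2 < 0"
      unfolding power2_minus by linarith+
    moreover have "\<beta> * (2 * Im z * k + k\<^sup>2) \<le> 0" "\<beta> * (2 * Im z * (- k) + (- k)\<^sup>2) \<le> 0"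
      using imag[of k] imag[of "- k"] k by simp_all
    ultimately have "\<beta> = 0"
      by (metis less_eq_real_def linorder_not_less linorder_neqE_linordered_idom mult_neg_neg mult_pos_pos)
    have "\<alpha> * h \<le> 0" if "\<bar>h\<bar> < d" for h
    proof -
      have "z + of_real h \<in> ball z d"
        using that by (simp add: dist_norm)
      from max[OF this] show ?thesis
        using \<open>\<beta> = 0\<close> by (simp add: algebra_simps)
    qed
    from this[of "d / 2"] this[of "- d / 2"] have "\<alpha> = 0"
      using d(1) by (simp add: mult_le_0_iff zero_le_mult_iff)
    with ab \<open>\<beta> = 0\<close> show False by simp
  qed
qed

lemma frontier_region:
  assumes "finite {x. complex_of_real x \<in> region}"
  shows "frontier region = curve"
  using curve_subset_region region_subset_interior_or_curve curve_disjoint_interior[OF assms]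
  unfolding frontier_def closure_closed[OF closed_region] by blast

end

section \<open>The two-dimensional case\<close>

lemma orthonormal_basis_dim_2:
  assumes "dim (UNIV :: 'a::real_inner set) = 2"
  obtains e1 e2 :: "'a::real_inner" where "inner e1 e1 = 1" "inner e2 e2 = 1" "inner e1 e2 = 0"
    "\<And>x. x = inner x e1 *\<^sub>R e1 + inner x e2 *\<^sub>R e2"
proof -
  obtain B :: "'a set" where B: "independent B" "UNIV \<subseteq> span B" "card B = 2"
    using basis_exists[of "UNIV :: 'a set"] assms by metis
  obtain b1 b2 where b: "B = {b1, b2}" "b1 \<noteq> b2"
    using B(3) by (auto simp: card_2_iff)
  have b1: "b1 \<noteq> 0"
    using B(1) b dependent_zero by auto
  have b2: "b2 \<notin> span {b1}"
    using B(1) b by (simp add: insert_commute[of b1] independent_insert)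
  define e1 where "e1 = b1 /\<^sub>R norm b1"
  define c where "c = b2 - inner b2 e1 *\<^sub>R e1"
  define e2 where "e2 = c /\<^sub>R norm c"
  have e11: "inner e1 e1 = 1"
    using b1 by (simp add: e1_def dot_square_norm power2_eq_square)
  have "inner b2 e1 *\<^sub>R e1 \<in> span {b1}"
    unfolding e1_def by (intro span_scale span_base) auto
  then have c: "c \<noteq> 0"
    using b2 by (auto simp: c_def)
  have e22: "inner e2 e2 = 1"
    using c by (simp add: e2_def dot_square_norm power2_eq_square)
  have e12: "inner e1 e2 = 0"
    using e11 by (simp add: e2_def c_def inner_diff_right inner_commute)
  have "b1 = norm b1 *\<^sub>R e1" "b2 = norm c *\<^sub>R e2 + inner b2 e1 *\<^sub>R e1"
    using b1 c by (simp_all add: e1_def e2_def c_def)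
  then have "b1 \<in> span {e1, e2}" "b2 \<in> span {e1, e2}"
    by (metis insertCI span_base span_scale, metis insertCI span_add span_base span_scale)
  then have "span B \<subseteq> span {e1, e2}"
    unfolding b by (intro span_minimal) auto
  then have "x \<in> span {e1, e2}" for x
    using B(2) by auto
  then have "\<exists>s r. x = s *\<^sub>R e1 + r *\<^sub>R e2" for x
    by (force simp: span_breakdown_eq diff_eq_eq add.commute)
  then have "x = inner x e1 *\<^sub>R e1 + inner x e2 *\<^sub>R e2" for x
    using e11 e22 e12 by (metis add.right_neutral add_0 inner_add_left inner_commute inner_scaleR_left mult.right_neutral mult_zero_right)
  then show ?thesis
    using that e11 e22 e12 by blast
qed

text \<open>The double-angle formulas: on the unit circle a quadratic form is an affine function of
  \<open>\<zeta>\<^sup>2\<close>. This is why the joint range of two forms is an ellipse.\<close>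

lemma form_in_plane_coordinates:
  fixes B :: "'a::real_vector \<Rightarrow> 'a \<Rightarrow> real" and e1 e2 :: 'a
  assumes B: "bilinear B" "\<And>x y. B x y = B y x"
  defines "v \<equiv> \<lambda>\<zeta>. Re \<zeta> *\<^sub>R e1 + Im \<zeta> *\<^sub>R e2"
  shows "B (v \<zeta>) (v \<zeta>) = (B e1 e1 + B e2 e2) / 2 * (cmod \<zeta>)\<^sup>2
    + (B e1 e1 - B e2 e2) / 2 * Re (\<zeta>\<^sup>2) + B e1 e2 * Im (\<zeta>\<^sup>2)"
  using B(2)[of e2 e1]
  by (simp add: v_def cmod_power2 bilinear_ladd[OF B(1)] bilinear_radd[OF B(1)]
      bilinear_lmul[OF B(1)] bilinear_rmul[OF B(1)]) (simp add: field_simps power2_eq_square)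

text \<open>Squares of unit numbers only give the circle, while unit pairs, as they occur in the
  complexification, fill the disc.\<close>

lemma cmod_le_1_iff_sum_two_squares:
  "cmod w \<le> 1 \<longleftrightarrow> (\<exists>\<zeta> \<eta>. (cmod \<zeta>)\<^sup>2 + (cmod \<eta>)\<^sup>2 = 1 \<and> w = \<zeta>\<^sup>2 + \<eta>\<^sup>2)"
proof
  assume w: "cmod w \<le> 1"
  define \<sigma> where "\<sigma> = cis (Arg w / 2)"
  \<comment> \<open>\<open>\<sigma>\<close> is a square root of the direction of \<open>w\<close>.
    The summands are to be \<open>a\<^sup>2\<close> and \<open>- b\<^sup>2\<close> times
    \<open>\<sigma>\<^sup>2\<close>, so \<open>a\<^sup>2 + b\<^sup>2\<close> must be 1 and
    \<open>a\<^sup>2 - b\<^sup>2\<close> must be \<open>cmod w\<close>.\<close>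
  define a b where "a = sqrt ((1 + cmod w) / 2)" and "b = sqrt ((1 - cmod w) / 2)"
  have ab: "a\<^sup>2 = (1 + cmod w) / 2" "b\<^sup>2 = (1 - cmod w) / 2"
    using w by (simp_all add: a_def b_def add_nonneg_nonneg)
  have "w = of_real (a\<^sup>2 - b\<^sup>2) * \<sigma>\<^sup>2"
    unfolding ab \<sigma>_def Complex.DeMoivre using rcis_cmod_Arg[of w]
    by (simp add: rcis_def field_simps)
  then have "w = (of_real a * \<sigma>)\<^sup>2 + (\<i> * of_real b * \<sigma>)\<^sup>2"
    by (simp add: power_mult_distrib algebra_simps)
  moreover have "(cmod (of_real a * \<sigma>))\<^sup>2 + (cmod (\<i> * of_real b * \<sigma>))\<^sup>2 = 1"
    using ab by (simp add: norm_mult \<sigma>_def field_simps)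
  ultimately show "\<exists>\<zeta> \<eta>. (cmod \<zeta>)\<^sup>2 + (cmod \<eta>)\<^sup>2 = 1 \<and> w = \<zeta>\<^sup>2 + \<eta>\<^sup>2" by blast
next
  assume "\<exists>\<zeta> \<eta>. (cmod \<zeta>)\<^sup>2 + (cmod \<eta>)\<^sup>2 = 1 \<and> w = \<zeta>\<^sup>2 + \<eta>\<^sup>2"
  then show "cmod w \<le> 1"
    using norm_triangle_ineq by (metis norm_power)
qed

lemma cmod_eq_1_iff_square: "cmod w = 1 \<longleftrightarrow> (\<exists>\<zeta>. cmod \<zeta> = 1 \<and> w = \<zeta>\<^sup>2)"
proof
  assume "cmod w = 1"
  moreover have "(cmod (csqrt w))\<^sup>2 = cmod w"
    by (simp flip: norm_power)
  ultimately show "\<exists>\<zeta>. cmod \<zeta> = 1 \<and> w = \<zeta>\<^sup>2"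
    by (intro exI[of _ "csqrt w"]) (auto simp: power2_eq_1_iff)
qed (auto simp: norm_power)

text \<open>A real point \<open>l\<close> is the equality case of Cauchy-Schwarz: the squared norms
  of \<open>T x - l *\<^sub>R x\<close> and \<open>T y - l *\<^sub>R y\<close> add up to 0, so
  \<open>l\<close> is an eigenvalue of \<open>T\<close>. This supplies the finiteness needed for
  \<open>frontier_region\<close>.\<close>

lemma finite_real_points_complex_SRG:
  fixes T :: "'a::real_inner \<Rightarrow> 'a" and U :: "'a \<Rightarrow> 'b::complex_inner" and e1 e2 :: 'a
  assumes T: "linear T" and "is_complexification U" "is_complexification_of U TC T"
    and e: "inner e1 e1 = 1" "inner e2 e2 = 1" "inner e1 e2 = 0"
      "\<And>x. x = inner x e1 *\<^sub>R e1 + inner x e2 *\<^sub>R e2"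
  shows "finite {l. complex_of_real l \<in> complex_SRG TC}"
proof -
  define a b c d where "a = inner (T e1) e1" and "b = inner (T e2) e1"
    and "c = inner (T e1) e2" and "d = inner (T e2) e2"
  \<comment> \<open>The characteristic polynomial of \<open>T\<close> in the basis
    \<open>e1\<close>, \<open>e2\<close>.\<close>
  define p where "p = [:a * d - b * c, - (a + d), 1:]"
  have eigen: "poly p l = 0" if l: "T x = l *\<^sub>R x" and x: "x \<noteq> 0" for l x
  proof -
    define s r where "s = inner x e1" and "r = inner x e2"
    have xsr: "x = s *\<^sub>R e1 + r *\<^sub>R e2"
      unfolding s_def r_def by (rule e(4))
    have "T x = s *\<^sub>R T e1 + r *\<^sub>R T e2"
      by (subst xsr) (simp add: linear_add[OF T] linear_scale[OF T])
    then have "l * s = s * a + r * b" "l * r = s * c + r * d"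
      using l by (auto simp: s_def r_def a_def b_def c_def d_def inner_add_left
          dest: arg_cong[where f = "\<lambda>v. inner v e1"] arg_cong[where f = "\<lambda>v. inner v e2"])
    then have "s * poly p l = 0" "r * poly p l = 0"
      unfolding p_def by (simp, algebra)+
    moreover have "s \<noteq> 0 \<or> r \<noteq> 0"
      using x xsr by auto
    ultimately show ?thesis by auto
  qed
  have "{l. complex_of_real l \<in> complex_SRG TC} \<subseteq> {l. poly p l = 0}"
  proof (intro subsetI CollectI)
    fix l assume "l \<in> {l. complex_of_real l \<in> complex_SRG TC}"
    then obtain x y where xy: "(norm x)\<^sup>2 + (norm y)\<^sup>2 = 1" "l = inner (T x) x + inner (T y) y"
        "l\<^sup>2 = (norm (T x))\<^sup>2 + (norm (T y))\<^sup>2"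
      by (auto simp: complex_SRG_iff[OF assms(2,3)])
    have exp: "(norm (T u - l *\<^sub>R u))\<^sup>2 = (norm (T u))\<^sup>2 - 2 * l * inner (T u) u + l\<^sup>2 * (norm u)\<^sup>2" for u
      by (simp add: power2_norm_eq_inner inner_diff_left inner_diff_right inner_commute[of u "T u"])
        (simp add: power2_eq_square algebra_simps)
    have "(norm (T x - l *\<^sub>R x))\<^sup>2 + (norm (T y - l *\<^sub>R y))\<^sup>2 =
        ((norm (T x))\<^sup>2 + (norm (T y))\<^sup>2) - 2 * l * (inner (T x) x + inner (T y) y)
        + l\<^sup>2 * ((norm x)\<^sup>2 + (norm y)\<^sup>2)"
      unfolding exp by (simp add: algebra_simps)
    also have "\<dots> = 0"
      unfolding xy(1) xy(2,3)[symmetric] by (simp add: power2_eq_square)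
    finally have "T x = l *\<^sub>R x" "T y = l *\<^sub>R y"
      by (simp_all add: sum_power2_eq_zero_iff)
    moreover have "x \<noteq> 0 \<or> y \<noteq> 0"
      using xy(1) by auto
    ultimately show "poly p l = 0"
      using eigen by blast
  qed
  moreover have "finite {l. poly p l = 0}"
    by (rule poly_roots_finite) (simp add: p_def)
  ultimately show ?thesis by (rule finite_subset)
qed

lemma real_SRG_eq_frontier:
  fixes T :: "'a::real_inner \<Rightarrow> 'a" and U :: "'a \<Rightarrow> 'b::complex_inner"
  assumes T: "linear T" and UT: "is_complexification U" "is_complexification_of U TC T"
    and dim: "dim (UNIV :: 'a set) = 2"
  shows "real_SRG T = frontier (complex_SRG TC)"
proof -
  obtain e1 e2 :: 'a where e: "inner e1 e1 = 1" "inner e2 e2 = 1" "inner e1 e2 = 0"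
      "\<And>x. x = inner x e1 *\<^sub>R e1 + inner x e2 *\<^sub>R e2"
    using orthonormal_basis_dim_2[OF dim] by blast
  \<comment> \<open>An isometry from the complex numbers, as a real plane, onto the space; it makes
    the squares \<open>\<zeta>\<^sup>2\<close> available as parameters of the ellipse.\<close>
  define v where "v \<zeta> = Re \<zeta> *\<^sub>R e1 + Im \<zeta> *\<^sub>R e2" for \<zeta>
  define f where "f = (\<lambda>x y. (inner (T x) y + inner (T y) x) / 2)"
  define g where "g = (\<lambda>x y. inner (T x) (T y))"
  have f: "bilinear f" "\<And>x y. f x y = f y x" and g: "bilinear g" "\<And>x y. g x y = g y x"
    using bilinear_shifted_forms[OF T, of 0] by (auto simp: f_def g_def inner_commute)
  interpret ellipse "(f e1 e1 + f e2 e2) / 2" "(f e1 e1 - f e2 e2) / 2" "f e1 e2"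
    "(g e1 e1 + g e2 e2) / 2" "(g e1 e1 - g e2 e2) / 2" "g e1 e2" .
  have fv: "inner (T (v \<zeta>)) (v \<zeta>) = (f e1 e1 + f e2 e2) / 2 * (cmod \<zeta>)\<^sup>2
      + (f e1 e1 - f e2 e2) / 2 * Re (\<zeta>\<^sup>2) + f e1 e2 * Im (\<zeta>\<^sup>2)" for \<zeta>
    using form_in_plane_coordinates[OF f, of \<zeta> e1 e2] by (simp add: v_def f_def)
  have gv: "(norm (T (v \<zeta>)))\<^sup>2 = (g e1 e1 + g e2 e2) / 2 * (cmod \<zeta>)\<^sup>2
      + (g e1 e1 - g e2 e2) / 2 * Re (\<zeta>\<^sup>2) + g e1 e2 * Im (\<zeta>\<^sup>2)" for \<zeta>
    using form_in_plane_coordinates[OF g, of \<zeta> e1 e2] by (simp add: v_def g_def power2_norm_eq_inner)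
  have norm_v: "(norm (v \<zeta>))\<^sup>2 = (cmod \<zeta>)\<^sup>2" for \<zeta>
    using e(1-3) by (simp add: v_def cmod_power2 power2_norm_eq_inner[where 'a = 'a] inner_add_left
        inner_add_right inner_commute) (simp add: power2_eq_square)
  have "\<exists>\<zeta>. x = v \<zeta>" for x
    using e(4)[of x] by (intro exI[of _ "Complex (inner x e1) (inner x e2)"]) (simp add: v_def)
  then have ex: "(\<exists>x. P x) \<longleftrightarrow> (\<exists>\<zeta>. P (v \<zeta>))" for P
    by metis
  have norm_v': "norm (v \<zeta>) = cmod \<zeta>" for \<zeta>
    using norm_v[of \<zeta>] by simp
  have curve_iff: "z \<in> curve \<longleftrightarrow> (\<exists>\<zeta>. cmod \<zeta> = 1 \<and>
      Re z = (f e1 e1 + f e2 e2) / 2 + (f e1 e1 - f e2 e2) / 2 * Re (\<zeta>\<^sup>2) + f e1 e2 * Im (\<zeta>\<^sup>2) \<and>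
      (cmod z)\<^sup>2 = (g e1 e1 + g e2 e2) / 2 + (g e1 e1 - g e2 e2) / 2 * Re (\<zeta>\<^sup>2) + g e1 e2 * Im (\<zeta>\<^sup>2))"
    for z
    unfolding curve_def mem_Collect_eq by (subst cmod_eq_1_iff_square) blast
  have region_iff: "z \<in> region \<longleftrightarrow> (\<exists>\<zeta> \<eta>. (cmod \<zeta>)\<^sup>2 + (cmod \<eta>)\<^sup>2 = 1 \<and>
      Re z = (f e1 e1 + f e2 e2) / 2 + (f e1 e1 - f e2 e2) / 2 * Re (\<zeta>\<^sup>2 + \<eta>\<^sup>2)
        + f e1 e2 * Im (\<zeta>\<^sup>2 + \<eta>\<^sup>2) \<and>
      (cmod z)\<^sup>2 = (g e1 e1 + g e2 e2) / 2 + (g e1 e1 - g e2 e2) / 2 * Re (\<zeta>\<^sup>2 + \<eta>\<^sup>2)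
        + g e1 e2 * Im (\<zeta>\<^sup>2 + \<eta>\<^sup>2))"
    for z
    unfolding region_def mem_Collect_eq by (subst cmod_le_1_iff_sum_two_squares) blast
  have "real_SRG T = curve"
    unfolding set_eq_iff real_SRG_iff ex curve_iff fv gv norm_v'
    by (simp cong: conj_cong)
  moreover have "complex_SRG TC = region"
  proof (rule set_eqI)
    fix z
    \<comment> \<open>The weights \<open>p\<close> and \<open>p'\<close> stand for the squared
      moduli of a unit pair, so the two constant terms combine to the centre of the ellipse.\<close>
    have sum: "(A * p + B * Re q + C * Im q) + (A * p' + B * Re q' + C * Im q') =
        A + B * Re (q + q') + C * Im (q + q')" if "p + p' = 1" for A B C p p' :: real and q q'
    proof -
      have "(A * p + B * Re q + C * Im q) + (A * p' + B * Re q' + C * Im q') =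
          A * (p + p') + B * Re (q + q') + C * Im (q + q')"
        by (simp add: algebra_simps)
      with that show ?thesis by simp
    qed
    show "z \<in> complex_SRG TC \<longleftrightarrow> z \<in> region"
      unfolding complex_SRG_iff[OF UT] ex region_iff fv gv norm_v
      by (simp only: sum cong: conj_cong)
  qed
  ultimately show ?thesis
    using frontier_region finite_real_points_complex_SRG[OF T UT e] by simp
qed

theorem theorem2:
  fixes T :: "'a::{real_inner, complete_space} \<Rightarrow> 'a"
    and U :: "'a \<Rightarrow> 'b::chilbert_space"
    and TC :: "'b \<Rightarrow> 'b"
  assumes "bounded_linear T"
    and "is_complexification U"
    and "is_complexification_of U TC T"
  shows "real_SRG T =
    (if dim (UNIV :: 'a set) = 2 then frontier (complex_SRG TC) else complex_SRG TC)"
proof -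
  have T: "linear T" using assms(1) by (rule bounded_linear.linear)
  show ?thesis
    using real_SRG_eq_frontier[OF T assms(2,3)] real_SRG_subset_complex_SRG[OF T assms(2,3)]
      complex_SRG_subset_real_SRG[OF T assms(2,3)]
    by auto
qed

end
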